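(* Let $f$, $c$, $F$ be as in the context and let $\epsilon>0$. For any initial condition $(\theta(0),r(0),v(0))=(\theta_0,r_0,v_0)$ with $\theta_0,v_0\in\mathbb{R}^n$ and $r_0>0$, the ODE system $$\epsilon\dot v=-v+\nabla F(\theta),\qquad \dot r=-2r|v|^2,\qquad \dot\theta=-2rv$$ admits a unique global solution $(\theta(t),v(t),r(t))\in C^1([0,\infty);\mathbb{R}^{2n+1})$. Specifically, for any $t>0$, $$\theta(t)\in\{\theta\in\mathbb{R}^n : F(\theta)\le F(\theta_0)+\epsilon r_0|v_0|^2\},$$ $$|v(t)|\le\max\Big\{|v(0)|,\ \max_{s\in[0,t]}|\nabla F(\theta(s))|\Big\},$$ $$0<r(t)\le r_0 .$$
   Context: Standing assumptions: $f:\mathbb{R}^n\to\mathbb{R}$ is $C^2$, coercive ($\lim_{|\theta|\to\infty}f(\theta)=\infty$) and bounded from below; $c\in\mathbb{R}$ is chosen so that, with $f^*=\min f$, $F(\theta):=\sqrt{f(\theta)+c}\ge F^*:=\sqrt{f^*+c}>0$ for all $\theta\in\mathbb{R}^n$. $|\cdot|$ is the Euclidean norm; a dot denotes the derivative in $t$. *)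

theory Defs
  imports "HOL-Analysis.Analysis"
begin

definition C2 :: "('a::real_normed_vector \<Rightarrow> real) \<Rightarrow> bool" where
  "C2 f \<longleftrightarrow> (\<exists>(f' :: 'a \<Rightarrow> 'a \<Rightarrow>\<^sub>L real) (f'' :: 'a \<Rightarrow> 'a \<Rightarrow>\<^sub>L 'a \<Rightarrow>\<^sub>L real).
     (\<forall>x. (f has_derivative blinfun_apply (f' x)) (at x)) \<and>
     (\<forall>x. (f' has_derivative blinfun_apply (f'' x)) (at x)) \<and>
     continuous_on UNIV f'')"

definition grad :: "('a::real_inner \<Rightarrow> real) \<Rightarrow> 'a \<Rightarrow> 'a" where
  "grad g x = (THE D. GDERIV g x :> D)"

(* Derivatives are relative to S, hence one-sided at boundary points of an interval;
   the library's C1_differentiable_on requires two-sided derivatives. *)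
definition C1_within :: "real set \<Rightarrow> (real \<Rightarrow> 'a::real_normed_vector) \<Rightarrow> bool" where
  "C1_within S u \<longleftrightarrow> (\<exists>u'. (\<forall>t\<in>S. (u has_vector_derivative u' t) (at t within S)) \<and>
     continuous_on S u')"

(* Minimum of a function and maximum over a set; unspecified if not attained. *)
definition min_value :: "('a \<Rightarrow> real) \<Rightarrow> real" where
  "min_value f = (LEAST y. y \<in> range f)"

definition max_over :: "'a set \<Rightarrow> ('a \<Rightarrow> real) \<Rightarrow> real" where
  "max_over S g = (GREATEST y. y \<in> g ` S)"

definition sqrt_shift :: "('a \<Rightarrow> real) \<Rightarrow> real \<Rightarrow> 'a \<Rightarrow> real" where
  "sqrt_shift f c x = sqrt (f x + c)"

(* Only the values of theta, v, r on [0,oo) matter. *)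
definition global_solution ::
  "real \<Rightarrow> ('a::euclidean_space \<Rightarrow> real) \<Rightarrow> 'a \<Rightarrow> 'a \<Rightarrow> real \<Rightarrow>
   (real \<Rightarrow> 'a) \<Rightarrow> (real \<Rightarrow> 'a) \<Rightarrow> (real \<Rightarrow> real) \<Rightarrow> bool" where
  "global_solution \<epsilon> F \<theta>\<^sub>0 v\<^sub>0 r\<^sub>0 \<theta> v r \<longleftrightarrow>
     C1_within {0..} (\<lambda>t. (\<theta> t, v t, r t)) \<and>
     \<theta> 0 = \<theta>\<^sub>0 \<and> v 0 = v\<^sub>0 \<and> r 0 = r\<^sub>0 \<and>
     (\<forall>t\<ge>0.
        \<epsilon> *\<^sub>R vector_derivative v (at t within {0..}) = - v t + grad F (\<theta> t) \<and>
        vector_derivative r (at t within {0..}) = - 2 * r t * (norm (v t))\<^sup>2 \<and>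
        vector_derivative \<theta> (at t within {0..}) = (- 2 * r t) *\<^sub>R v t)"

end

theory Submission
  imports Defs
begin

text \<open>
  The vector field of the system is locally Lipschitz because \<open>F\<close> is of class C2, so that \<open>grad F\<close>
  is locally Lipschitz (\<open>C2_sqrt_shift_gradient\<close>). Uniqueness follows from a Gronwall argument
  (\<open>integral_curve_unique\<close>). What has to be excluded for global existence is blow-up in finite time,
  and this is done by three a priori estimates for a solution on a compact interval.

  The equation of \<open>r\<close> is linear in \<open>r\<close>, so \<open>r\<close> remains positive, and then it decreases. The energy
  \<open>F \<theta> + \<epsilon> * r * (norm v)\<^sup>2\<close> decreases too (\<open>energy_le_initial\<close>), so \<open>\<theta>\<close> never leaves the sublevel set
  of \<open>F\<close> at the initial energy. This set is bounded because \<open>f\<close> is coercive, hence \<open>grad F\<close> is bounded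
  along the solution. Finally \<open>v\<close> relaxes exponentially towards \<open>grad F \<theta>\<close>, so it is bounded by its
  initial norm or by the largest norm of the gradient so far (\<open>norm_v_le\<close>).

  Since the resulting bound is the same for all intervals, projecting the argument of the field onto
  a larger ball changes the field to a globally Lipschitz one but does not change the solution
  (\<open>global_integral_curve_a_priori_bound\<close>). For a globally Lipschitz field a single application of the
  Banach fixed point theorem, in an exponentially weighted norm, gives a solution for all times
  (\<open>global_integral_curve_lipschitz\<close>). The estimates of the theorem are the a priori estimates again.
\<close>

section \<open>Integral curves of Lipschitz fields on the half-line\<close>

definition integral_curve :: "('a::real_normed_vector \<Rightarrow> 'a) \<Rightarrow> real set \<Rightarrow> (real \<Rightarrow> 'a) \<Rightarrow> bool" where
  "integral_curve g S x \<longleftrightarrow> (\<forall>t\<in>S. (x has_vector_derivative g (x t)) (at t within S))"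

text \<open>
  Derivatives on \<open>{0..}\<close> and on \<open>{0..T}\<close> are one-sided at the end points. Away from the
  right end the two notions agree, which lets results about compact intervals pass to the half-line.
\<close>
lemma at_within_Icc_eq_Ici:
  fixes a b t :: real
  assumes "t < b"
  shows "at t within {a..b} = at t within {a..}"
  by (rule at_within_nhd[of t "{..<b}"]) (use assms in auto)

lemma integral_has_vector_derivative_Ici:
  fixes h :: "real \<Rightarrow> 'a::banach"
  assumes "continuous_on {a..} h" and "a \<le> t"
  shows "((\<lambda>u. integral {a..u} h) has_vector_derivative h t) (at t within {a..})"
proof -
  have "continuous_on {a..t+1} h"
    using assms(1) by (rule continuous_on_subset) auto
  from integral_has_vector_derivative[OF this, of t] show ?thesis
    using assms(2) by (simp add: at_within_Icc_eq_Ici)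
qed

lemma continuous_on_integral_Ici:
  fixes h :: "real \<Rightarrow> 'a::banach"
  assumes "continuous_on {a..} h"
  shows "continuous_on {a..} (\<lambda>t. integral {a..t} h)"
  unfolding continuous_on_eq_continuous_within
  using integral_has_vector_derivative_Ici[OF assms] has_vector_derivative_continuous by fastforce

lemma integral_curve_subset:
  "integral_curve g S x \<Longrightarrow> T \<subseteq> S \<Longrightarrow> integral_curve g T x"
  unfolding integral_curve_def by (blast intro: has_vector_derivative_within_subset)

lemma integral_curve_continuous_on: "integral_curve g S x \<Longrightarrow> continuous_on S x"
  unfolding integral_curve_def
  by (auto simp: continuous_on_eq_continuous_within intro: has_vector_derivative_continuous)

lemma nonincreasing_Icc:
  fixes w :: "real \<Rightarrow> real"
  assumes "a \<le> b"
    and deriv: "\<And>t. t \<in> {a..b} \<Longrightarrow> (w has_real_derivative w' t) (at t within {a..b})"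
    and nonpos: "\<And>t. t \<in> {a..b} \<Longrightarrow> w' t \<le> 0"
  shows "w b \<le> w a"
proof (rule DERIV_nonpos_imp_decreasing_open[OF assms(1)])
  show "\<exists>y. DERIV w t :> y \<and> y \<le> 0" if "a < t" "t < b" for t
    using deriv[of t] nonpos[of t] that by (auto simp: at_within_Icc_at)
  show "continuous_on {a..b} w"
    using deriv DERIV_continuous continuous_on_eq_continuous_within by blast
qed

text \<open>
  Integration gains a factor \<open>1 / k\<close> on functions of growth \<open>exp (k * s)\<close>, because
  \<open>C / k * exp (k * s)\<close> is a primitive of the bound \<open>C * exp (k * s)\<close>. This gain is what makes the
  Picard operator a contraction for large \<open>k\<close>, on the whole half-line at once.
\<close>
lemma exp_weighted_integral_bound:
  fixes h :: "real \<Rightarrow> 'a::banach"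
  assumes cont: "continuous_on {0..} h" and "0 < k" and "0 \<le> t"
    and bnd: "\<And>s. 0 \<le> s \<Longrightarrow> norm (h s) \<le> C * exp (k * s)"
  shows "norm (exp (- (k * t)) *\<^sub>R integral {0..t} h) \<le> C / k"
proof -
  have "0 \<le> C"
    using bnd[of 0] order_trans[OF norm_ge_zero] by simp
  have d: "((\<lambda>u. integral {0..u} h) has_vector_derivative h s) (at s within {0..})" if "0 \<le> s" for s
    using integral_has_vector_derivative_Ici[OF cont] that by simp
  have "norm (integral {0..t} h) \<le> C / k * exp (k * t)"
  proof (cases "t = 0")
    case False
    with \<open>0 \<le> t\<close> have "0 < t" by simp
    have "norm (integral {0..t} h - integral {0..0} h)
        \<le> (\<lambda>s. C / k * exp (k * s)) t - (\<lambda>s. C / k * exp (k * s)) 0"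
    proof (rule differentiable_bound_general[OF \<open>0 < t\<close>])
      show "continuous_on {0..t} (\<lambda>u. integral {0..u} h)"
        using continuous_on_integral_Ici[OF cont] by (rule continuous_on_subset) auto
      show "continuous_on {0..t} (\<lambda>s. C / k * exp (k * s))"
        by (intro continuous_intros)
      fix s assume s: "0 < s" "s < t"
      show "((\<lambda>u. integral {0..u} h) has_vector_derivative h s) (at s)"
        using d[of s] s by (simp add: at_within_interior[of s "{0..}"])
      show "((\<lambda>s. C / k * exp (k * s)) has_vector_derivative C * exp (k * s)) (at s)"
        unfolding has_real_derivative_iff_has_vector_derivative[symmetric]
        by (rule derivative_eq_intros refl)+ (use \<open>0 < k\<close> in simp)
      show "norm (h s) \<le> C * exp (k * s)"
        using bnd s by simp
    qed
    also have "\<dots> \<le> C / k * exp (k * t)"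
      using \<open>0 \<le> C\<close> \<open>0 < k\<close> by simp
    finally show ?thesis by simp
  qed (use \<open>0 \<le> C\<close> \<open>0 < k\<close> in simp)
  then have "exp (- (k * t)) * norm (integral {0..t} h) \<le> exp (- (k * t)) * (C / k * exp (k * t))"
    by (intro mult_left_mono) auto
  also have "\<dots> = C / k"
    by (simp add: exp_minus)
  finally show ?thesis by simp
qed

text \<open>
  The Picard-Lindelof theorem for a globally Lipschitz field. Writing a candidate solution as
  \<open>x\<^sub>0 + exp (k * t) *\<^sub>R u t\<close> with \<open>u\<close> bounded and continuous (Bielecki's weighted norm), the integral
  equation becomes a fixed point equation for \<open>u\<close>. The Lipschitz constant \<open>K\<close> of the field and the gain
  \<open>1 / k\<close> of the integral give the contraction factor \<open>K / k\<close>, so the Banach fixed point theorem yields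
  a solution for all times, with no gluing of local solutions.
\<close>
theorem global_integral_curve_lipschitz:
  fixes g :: "'a::banach \<Rightarrow> 'a"
  assumes "L-lipschitz_on UNIV g"
  obtains x where "x 0 = x\<^sub>0" "integral_curve g {0..} x"
proof -
  \<comment> \<open>The Lipschitz constant is enlarged to be positive, as one divides by \<open>k = 2 * K\<close> below.\<close>
  define K where "K = L + 1"
  have K: "K-lipschitz_on UNIV g" "0 < K"
    using lipschitz_on_le[OF assms, of K] lipschitz_on_nonneg[OF assms] by (auto simp: K_def)
  have gcont: "continuous_on S g" for S
    using lipschitz_on_continuous_on[OF K(1)] by (rule continuous_on_subset) simp
  have glip: "norm (g a - g b) \<le> K * norm (a - b)" for a b
    using lipschitz_on_normD[OF K(1), of a b] by simp
  \<comment> \<open>With this weight the contraction factor \<open>K / k\<close> is one half.\<close>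
  define k where "k = 2 * K"
  have "0 < k" using K(2) by (simp add: k_def)
  define h where "h u s = g (x\<^sub>0 + exp (k * s) *\<^sub>R apply_bcontfun u s)" for u :: "real \<Rightarrow>\<^sub>C 'a" and s
  \<comment> \<open>Here \<open>u\<close> is a function on the whole real line; \<open>max 0 t\<close> extends the image constantly to negative times.\<close>
  define P where "P u t = exp (- (k * max 0 t)) *\<^sub>R integral {0..max 0 t} (h u)"
    for u :: "real \<Rightarrow>\<^sub>C 'a" and t :: real
  have hcont: "continuous_on S (h u)" for S u
    unfolding h_def by (rule continuous_on_compose2[OF gcont[of UNIV]]) (auto intro!: continuous_intros)
  have hint: "h u integrable_on {0..t}" for u t
    by (rule integrable_continuous_real[OF hcont])
  have hbound: "norm (h u s) \<le> (norm (g x\<^sub>0) + K * norm u) * exp (k * s)" if "0 \<le> s" for u s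
  proof -
    have "norm (h u s) \<le> norm (g x\<^sub>0) + norm (g (x\<^sub>0 + exp (k * s) *\<^sub>R apply_bcontfun u s) - g x\<^sub>0)"
      unfolding h_def by (metis norm_triangle_sub)
    also have "\<dots> \<le> norm (g x\<^sub>0) + K * norm (exp (k * s) *\<^sub>R apply_bcontfun u s)"
      using glip[of "x\<^sub>0 + exp (k * s) *\<^sub>R apply_bcontfun u s" x\<^sub>0] by simp
    also have "\<dots> \<le> norm (g x\<^sub>0) * exp (k * s) + K * (exp (k * s) * norm u)"
      using K(2) \<open>0 < k\<close> that norm_bounded[of u s]
      by (intro add_mono mult_left_mono) (auto simp: mult_le_cancel_left1)
    finally show ?thesis by (simp add: algebra_simps)
  qed
  have "P u \<in> bcontfun" for u
  proof (rule bcontfun_normI)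
    have "continuous_on UNIV (\<lambda>t. integral {0..max 0 t} (h u))"
      by (rule continuous_on_compose2[OF continuous_on_integral_Ici[OF hcont]]) (auto intro!: continuous_intros)
    then show "continuous_on UNIV (P u)"
      unfolding P_def by (intro continuous_intros)
    show "norm (P u t) \<le> (norm (g x\<^sub>0) + K * norm u) / k" for t
      unfolding P_def by (rule exp_weighted_integral_bound[OF hcont \<open>0 < k\<close>]) (auto simp: hbound)
  qed
  then have P: "apply_bcontfun (Bcontfun (P u)) = P u" for u
    by (rule Bcontfun_inverse)
  have "\<exists>!u. Bcontfun (P u) = u"
  proof (rule banach_fix_type[of "1/2"], safe)
    fix u w :: "real \<Rightarrow>\<^sub>C 'a"
    show "dist (Bcontfun (P u)) (Bcontfun (P w)) \<le> 1 / 2 * dist u w"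
    proof (rule dist_bound)
      fix t
      have "P u t - P w t = exp (- (k * max 0 t)) *\<^sub>R integral {0..max 0 t} (\<lambda>s. h u s - h w s)"
        unfolding P_def by (simp add: integral_diff[OF hint hint] scaleR_diff_right)
      also have "norm \<dots> \<le> (K * dist u w) / k"
      proof (rule exp_weighted_integral_bound[OF _ \<open>0 < k\<close>])
        fix s :: real assume "0 \<le> s"
        have "norm (h u s - h w s) \<le> K * norm (exp (k * s) *\<^sub>R (apply_bcontfun u s - apply_bcontfun w s))"
          using glip[of "x\<^sub>0 + exp (k * s) *\<^sub>R apply_bcontfun u s" "x\<^sub>0 + exp (k * s) *\<^sub>R apply_bcontfun w s"]
          by (simp add: h_def scaleR_diff_right)
        also have "\<dots> \<le> K * (exp (k * s) * dist u w)"
          using K(2) dist_bounded[of u s w] by (auto simp: dist_norm)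
        finally show "norm (h u s - h w s) \<le> (K * dist u w) * exp (k * s)"
          by (simp add: algebra_simps)
      qed (auto intro!: continuous_intros hcont)
      also have "\<dots> = 1 / 2 * dist u w"
        using K(2) by (simp add: k_def)
      finally show "dist (apply_bcontfun (Bcontfun (P u)) t) (apply_bcontfun (Bcontfun (P w)) t) \<le> 1 / 2 * dist u w"
        by (simp add: P dist_norm)
    qed
  qed auto
  then obtain u where "Bcontfun (P u) = u" by blast
  with P have u: "apply_bcontfun u t = P u t" for t by metis
  define x where "x t = x\<^sub>0 + integral {0..t} (h u)" for t
  have x: "h u t = g (x t)" if "0 \<le> t" for t
    using that by (simp add: h_def u x_def P_def exp_minus)
  have "integral_curve g {0..} x"
    unfolding integral_curve_def x_def[abs_def]
    using integral_has_vector_derivative_Ici[OF hcont] x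
    by (auto simp: x_def intro!: derivative_eq_intros)
  moreover have "x 0 = x\<^sub>0" by (simp add: x_def)
  ultimately show thesis using that by blast
qed

section \<open>Uniqueness and global existence for locally Lipschitz fields\<close>

text \<open>
  In Euclidean spaces this is local Lipschitz continuity. The formulation by balls gives one constant
  for any two points of a bounded set, which is how the condition is used.
\<close>
definition lipschitz_on_balls :: "('a::real_normed_vector \<Rightarrow> 'b::real_normed_vector) \<Rightarrow> bool" where
  "lipschitz_on_balls g \<longleftrightarrow> (\<forall>R. \<exists>L. L-lipschitz_on (cball 0 R) g)"

lemma lipschitz_on_ballsE:
  assumes "lipschitz_on_balls g"
  obtains L where "0 \<le> L" "\<And>x y. norm x \<le> R \<Longrightarrow> norm y \<le> R \<Longrightarrow> norm (g x - g y) \<le> L * norm (x - y)"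
proof -
  obtain L where "L-lipschitz_on (cball 0 R) g"
    using assms unfolding lipschitz_on_balls_def by blast
  then show thesis
    using that lipschitz_on_normD[of L "cball 0 R" g] lipschitz_on_nonneg[of L "cball 0 R" g] by simp
qed

text \<open>
  Both curves stay in a ball on which the field has a Lipschitz constant \<open>L\<close>. Hence
  \<open>w t = exp (- 2 * L * t) * (norm (x t - y t))\<^sup>2\<close> cannot increase: the derivative of the squared
  distance is at most \<open>2 * L\<close> times itself. As \<open>w\<close> starts at zero, it stays there.
\<close>
theorem integral_curve_unique:
  fixes g :: "'a::real_inner \<Rightarrow> 'a"
  assumes lip: "lipschitz_on_balls g" and "0 \<le> T"
    and x: "integral_curve g {0..T} x" and y: "integral_curve g {0..T} y" and init: "x 0 = y 0"
  shows "x T = y T"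
proof -
  have "bounded (x ` {0..T} \<union> y ` {0..T})"
    using x y by (auto intro!: compact_imp_bounded compact_continuous_image integral_curve_continuous_on)
  then obtain R where "\<And>z. z \<in> x ` {0..T} \<union> y ` {0..T} \<Longrightarrow> norm z \<le> R"
    unfolding bounded_iff by blast
  then have R: "norm (x t) \<le> R" "norm (y t) \<le> R" if "t \<in> {0..T}" for t
    using that by auto
  obtain L where L: "0 \<le> L" "\<And>a b. norm a \<le> R \<Longrightarrow> norm b \<le> R \<Longrightarrow> norm (g a - g b) \<le> L * norm (a - b)"
    by (rule lipschitz_on_ballsE[OF lip, of R]) blast
  define w where "w t = exp (- 2 * L * t) * ((x t - y t) \<bullet> (x t - y t))" for t
  have "w T \<le> w 0"
  proof (rule nonincreasing_Icc[OF \<open>0 \<le> T\<close>])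
    fix t assume t: "t \<in> {0..T}"
    have "(x has_derivative (\<lambda>h. h *\<^sub>R g (x t))) (at t within {0..T})"
      "(y has_derivative (\<lambda>h. h *\<^sub>R g (y t))) (at t within {0..T})"
      using x y t by (auto simp: integral_curve_def has_vector_derivative_def)
    then show "(w has_real_derivative
        exp (- 2 * L * t) * (2 * ((g (x t) - g (y t)) \<bullet> (x t - y t)) - 2 * L * ((x t - y t) \<bullet> (x t - y t))))
        (at t within {0..T})"
      unfolding w_def has_field_derivative_def
      by (auto intro!: derivative_eq_intros ext simp: algebra_simps inner_commute)
    have "(g (x t) - g (y t)) \<bullet> (x t - y t) \<le> norm (g (x t) - g (y t)) * norm (x t - y t)"
      by (rule norm_cauchy_schwarz)
    also have "\<dots> \<le> L * norm (x t - y t) * norm (x t - y t)"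
      using L(2)[of "x t" "y t"] R[OF t] by (intro mult_right_mono) auto
    finally have "(g (x t) - g (y t)) \<bullet> (x t - y t) \<le> L * ((x t - y t) \<bullet> (x t - y t))"
      by (simp add: dot_square_norm power2_eq_square mult.assoc)
    then show "exp (- 2 * L * t) * (2 * ((g (x t) - g (y t)) \<bullet> (x t - y t)) - 2 * L * ((x t - y t) \<bullet> (x t - y t))) \<le> 0"
      by (simp add: mult_le_0_iff)
  qed
  then have "(x T - y T) \<bullet> (x T - y T) \<le> 0"
    by (simp add: w_def init mult_le_0_iff)
  then show ?thesis
    by (metis eq_iff_diff_eq_0 inner_gt_zero_iff linorder_not_less)
qed

text \<open>
  A locally Lipschitz field has a global integral curve as soon as its integral curves on compact
  intervals satisfy a bound \<open>B\<close> independent of the interval. Composing the field with the projection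
  onto a ball of radius \<open>R > B\<close> makes it globally Lipschitz, so the modified field has a global integral
  curve. Up to the first time at which this curve has norm \<open>R\<close> it is an integral curve of the original
  field, and then the bound \<open>B < R\<close> excludes that such a time exists.
\<close>
theorem global_integral_curve_a_priori_bound:
  fixes g :: "'a::euclidean_space \<Rightarrow> 'a"
  assumes lip: "lipschitz_on_balls g"
    and bound: "\<And>T x. 0 \<le> T \<Longrightarrow> integral_curve g {0..T} x \<Longrightarrow> x 0 = x\<^sub>0 \<Longrightarrow> norm (x T) \<le> B"
  obtains x where "x 0 = x\<^sub>0" "integral_curve g {0..} x"
proof -
  define R where "R = max B (norm x\<^sub>0) + 1"
  have R: "B < R" "norm x\<^sub>0 < R" "0 \<le> R"
    using norm_ge_zero[of x\<^sub>0] unfolding R_def by linarith+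
  let ?p = "closest_point (cball (0::'a) R)"
  have p_in: "?p z \<in> cball 0 R" for z
    using R(3) by (intro closest_point_in_set) auto
  obtain L where L: "L-lipschitz_on (cball 0 R) g"
    using lip unfolding lipschitz_on_balls_def by blast
  have "1-lipschitz_on UNIV ?p"
    using R(3) by (intro lipschitz_onI) (auto intro!: closest_point_lipschitz)
  moreover have "L-lipschitz_on (range ?p) g"
    using L by (rule lipschitz_on_subset) (use p_in in auto)
  ultimately have "(L * 1)-lipschitz_on UNIV (\<lambda>z. g (?p z))"
    by (rule lipschitz_on_compose2)
  then obtain x where x0: "x 0 = x\<^sub>0" and x: "integral_curve (\<lambda>z. g (?p z)) {0..} x"
    by (rule global_integral_curve_lipschitz)
  have xcont: "continuous_on S x" if "S \<subseteq> {0..}" for S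
    using integral_curve_continuous_on[OF x] that by (rule continuous_on_subset)
  have original: "integral_curve g S x" if "S \<subseteq> {0..}" "\<And>t. t \<in> S \<Longrightarrow> norm (x t) \<le> R" for S
    using integral_curve_subset[OF x that(1)] that(2)
    by (auto simp: integral_curve_def closest_point_self)
  have inside: "norm (x t) < R" if "0 \<le> t" for t
  proof (rule ccontr)
    assume contra: "\<not> norm (x t) < R"
    \<comment> \<open>The first time \<open>\<tau>\<close> outside the open ball exists by compactness; by the intermediate value theorem the norm is exactly \<open>R\<close> there.\<close>
    define S where "S = {s \<in> {0..t}. x s \<in> - ball 0 R}"
    have "compact S"
      unfolding compact_eq_bounded_closed
    proof
      show "closed S" unfolding S_def
        by (intro continuous_closed_preimage[unfolded vimage_def Int_def mem_Collect_eq] xcont) auto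
      show "bounded S"
        by (rule bounded_subset[of "{0..t}"]) (auto simp: S_def)
    qed
    moreover have "t \<in> S"
      using that contra by (simp add: S_def)
    ultimately obtain \<tau> where \<tau>: "\<tau> \<in> S" "\<And>s. s \<in> S \<Longrightarrow> \<tau> \<le> s"
      using compact_attains_inf[of S] by blast
    have "\<exists>s\<ge>0. s \<le> \<tau> \<and> norm (x s) = R"
    proof (rule IVT')
      show "continuous_on {0..\<tau>} (\<lambda>s. norm (x s))"
        by (intro continuous_on_norm xcont) auto
    qed (use \<tau>(1) R(2) in \<open>simp_all add: S_def x0\<close>)
    then obtain s where s: "0 \<le> s" "s \<le> \<tau>" "norm (x s) = R" by blast
    then have "s \<in> S" using \<tau>(1) by (simp add: S_def)
    with \<tau>(2) s(2) have "s = \<tau>" by force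
    with s have \<tau>R: "norm (x \<tau>) = R" "0 \<le> \<tau>" by auto
    have "norm (x s) \<le> R" if "s \<in> {0..\<tau>}" for s
    proof (cases "s \<in> S")
      case True
      with \<tau>(2)[of s] that \<tau>R(1) show ?thesis by simp
    next
      case False
      with \<tau>(1) that show ?thesis by (simp add: S_def)
    qed
    then have "integral_curve g {0..\<tau>} x"
      by (intro original) auto
    from bound[OF \<tau>R(2) this x0] R(1) \<tau>R(1) show False by simp
  qed
  then have "integral_curve g {0..} x"
    by (intro original) (auto intro: less_imp_le)
  with x0 that show thesis by blast
qed

section \<open>Functions that are Lipschitz on balls\<close>

lemma lipschitz_on_ballsI:
  fixes g :: "'a::real_normed_vector \<Rightarrow> 'b::real_normed_vector"
  assumes "\<And>R. \<exists>L. \<forall>x y. norm x \<le> R \<longrightarrow> norm y \<le> R \<longrightarrow> norm (g x - g y) \<le> L * norm (x - y)"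
  shows "lipschitz_on_balls g"
  unfolding lipschitz_on_balls_def
proof
  fix R
  obtain L where L: "\<And>x y. norm x \<le> R \<Longrightarrow> norm y \<le> R \<Longrightarrow> norm (g x - g y) \<le> L * norm (x - y)"
    using assms by blast
  have "\<bar>L\<bar>-lipschitz_on (cball 0 R) g"
  proof (rule lipschitz_onI)
    fix x y :: 'a assume "x \<in> cball 0 R" "y \<in> cball 0 R"
    then have "norm (g x - g y) \<le> L * norm (x - y)" using L by simp
    also have "\<dots> \<le> \<bar>L\<bar> * norm (x - y)" by (intro mult_right_mono) auto
    finally show "dist (g x) (g y) \<le> \<bar>L\<bar> * dist x y" by (simp add: dist_norm)
  qed simp
  then show "\<exists>L. L-lipschitz_on (cball 0 R) g" by blast
qed

lemma lipschitz_on_balls_bounded: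
  fixes g :: "'a::real_normed_vector \<Rightarrow> 'b::real_normed_vector"
  assumes "lipschitz_on_balls g"
  obtains M where "0 \<le> M" "\<And>x. norm x \<le> R \<Longrightarrow> norm (g x) \<le> M"
proof (cases "0 \<le> R")
  case True
  obtain L where L: "0 \<le> L" "\<And>x y. norm x \<le> R \<Longrightarrow> norm y \<le> R \<Longrightarrow> norm (g x - g y) \<le> L * norm (x - y)"
    by (rule lipschitz_on_ballsE[OF assms, of R]) blast
  show thesis
  proof (rule that)
    fix x :: 'a assume x: "norm x \<le> R"
    have "norm (g x) \<le> norm (g 0) + norm (g x - g 0)" by (metis norm_triangle_sub)
    also have "\<dots> \<le> norm (g 0) + L * R"
      using L(2)[of x 0] x True mult_left_mono[OF x L(1)] by simp
    finally show "norm (g x) \<le> norm (g 0) + L * R" .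
  qed (use L(1) True in simp)
next
  case False
  then show thesis
    using that[of 0] order_trans[OF norm_ge_zero, of _ R] by auto
qed

lemma lipschitz_on_balls_continuous_on:
  fixes g :: "'a::real_normed_vector \<Rightarrow> 'b::real_normed_vector"
  assumes "lipschitz_on_balls g"
  shows "continuous_on S g"
proof -
  have "isCont g x" for x
  proof -
    obtain L where "L-lipschitz_on (cball 0 (norm x + 1)) g"
      using assms unfolding lipschitz_on_balls_def by blast
    then have "continuous_on (ball 0 (norm x + 1)) g"
      by (rule continuous_on_subset[OF lipschitz_on_continuous_on]) auto
    then show ?thesis
      by (rule continuous_on_interior) auto
  qed
  then show ?thesis by (simp add: continuous_at_imp_continuous_on)
qed

lemma lipschitz_on_balls_Pair:
  "lipschitz_on_balls f \<Longrightarrow> lipschitz_on_balls g \<Longrightarrow> lipschitz_on_balls (\<lambda>x. (f x, g x))"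
  unfolding lipschitz_on_balls_def by (blast intro: lipschitz_on_Pair)

lemma lipschitz_on_balls_add:
  "lipschitz_on_balls f \<Longrightarrow> lipschitz_on_balls g \<Longrightarrow> lipschitz_on_balls (\<lambda>x. f x + g x)"
  unfolding lipschitz_on_balls_def by (blast intro: lipschitz_on_add)

lemma lipschitz_on_balls_minus:
  "lipschitz_on_balls f \<Longrightarrow> lipschitz_on_balls (\<lambda>x. - f x)"
  unfolding lipschitz_on_balls_def by (blast intro: lipschitz_on_minus)

lemma lipschitz_on_balls_const: "lipschitz_on_balls (\<lambda>x. c)"
  unfolding lipschitz_on_balls_def by (blast intro: lipschitz_on_constant)

lemma lipschitz_on_balls_linear: "bounded_linear f \<Longrightarrow> lipschitz_on_balls f"
  unfolding lipschitz_on_balls_def by (blast elim: bounded_linear.lipschitz_boundE)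

lemma lipschitz_on_balls_compose:
  assumes g: "lipschitz_on_balls g" and f: "lipschitz_on_balls f"
  shows "lipschitz_on_balls (\<lambda>x. g (f x))"
  unfolding lipschitz_on_balls_def
proof
  fix R
  obtain M where M: "0 \<le> M" "\<And>x. norm x \<le> R \<Longrightarrow> norm (f x) \<le> M"
    by (rule lipschitz_on_balls_bounded[OF f, of R]) blast
  obtain L where L: "L-lipschitz_on (cball 0 R) f"
    using f unfolding lipschitz_on_balls_def by blast
  obtain K where "K-lipschitz_on (cball 0 M) g"
    using g unfolding lipschitz_on_balls_def by blast
  then have "K-lipschitz_on (f ` cball 0 R) g"
    by (rule lipschitz_on_subset) (use M in auto)
  with L show "\<exists>L. L-lipschitz_on (cball 0 R) (\<lambda>x. g (f x))"
    by (blast intro: lipschitz_on_compose2)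
qed

text \<open>
  The product of two Lipschitz functions need not be Lipschitz, but on a ball both factors are
  bounded as well, and then it is.
\<close>
lemma lipschitz_on_balls_bilinear:
  assumes "bounded_bilinear p" and f: "lipschitz_on_balls f" and g: "lipschitz_on_balls g"
  shows "lipschitz_on_balls (\<lambda>x. p (f x) (g x))"
proof (rule lipschitz_on_ballsI)
  fix R
  interpret p: bounded_bilinear p by fact
  obtain C where C: "0 \<le> C" "\<And>a b. norm (p a b) \<le> norm a * norm b * C"
    using p.nonneg_bounded by blast
  obtain L where L: "0 \<le> L" "\<And>x y. norm x \<le> R \<Longrightarrow> norm y \<le> R \<Longrightarrow> norm (f x - f y) \<le> L * norm (x - y)"
    by (rule lipschitz_on_ballsE[OF f, of R]) blast
  obtain K where K: "0 \<le> K" "\<And>x y. norm x \<le> R \<Longrightarrow> norm y \<le> R \<Longrightarrow> norm (g x - g y) \<le> K * norm (x - y)"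
    by (rule lipschitz_on_ballsE[OF g, of R]) blast
  obtain M where M: "0 \<le> M" "\<And>x. norm x \<le> R \<Longrightarrow> norm (f x) \<le> M"
    by (rule lipschitz_on_balls_bounded[OF f, of R]) blast
  obtain N where N: "0 \<le> N" "\<And>x. norm x \<le> R \<Longrightarrow> norm (g x) \<le> N"
    by (rule lipschitz_on_balls_bounded[OF g, of R]) blast
  have "norm (p (f x) (g x) - p (f y) (g y)) \<le> ((M * K + L * N) * C) * norm (x - y)"
    if "norm x \<le> R" "norm y \<le> R" for x y
  proof -
    have "p (f x) (g x) - p (f y) (g y) = p (f x) (g x - g y) + p (f x - f y) (g y)"
      by (simp add: p.diff_left p.diff_right)
    also have "norm \<dots> \<le> norm (f x) * norm (g x - g y) * C + norm (f x - f y) * norm (g y) * C"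
      by (intro order_trans[OF norm_triangle_ineq] add_mono C)
    also have "\<dots> \<le> M * (K * norm (x - y)) * C + (L * norm (x - y)) * N * C"
      using that C(1) L K M N by (intro add_mono mult_mono mult_right_mono) auto
    finally show ?thesis by (simp add: algebra_simps)
  qed
  then show "\<exists>L. \<forall>x y. norm x \<le> R \<longrightarrow> norm y \<le> R \<longrightarrow>
      norm (p (f x) (g x) - p (f y) (g y)) \<le> L * norm (x - y)"
    by blast
qed

lemma lipschitz_on_balls_inverse:
  fixes g :: "'a::real_normed_vector \<Rightarrow> real"
  assumes g: "lipschitz_on_balls g" and "0 < m" "\<And>x. m \<le> g x"
  shows "lipschitz_on_balls (\<lambda>x. inverse (g x))"
proof (rule lipschitz_on_ballsI)
  fix R
  obtain L where L: "0 \<le> L" "\<And>x y. norm x \<le> R \<Longrightarrow> norm y \<le> R \<Longrightarrow> norm (g x - g y) \<le> L * norm (x - y)"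
    by (rule lipschitz_on_ballsE[OF g, of R]) blast
  have "norm (inverse (g x) - inverse (g y)) \<le> (L / (m * m)) * norm (x - y)"
    if "norm x \<le> R" "norm y \<le> R" for x y
  proof -
    have pos: "0 < g x" "0 < g y" using assms(2,3) less_le_trans by blast+
    have "norm (inverse (g x) - inverse (g y)) = norm (g x - g y) / (g x * g y)"
      using pos by (simp add: inverse_diff_inverse norm_mult abs_mult abs_minus_commute divide_simps)
    also have "\<dots> \<le> (L * norm (x - y)) / (m * m)"
      using L that assms(2,3) pos by (intro frac_le mult_mono) auto
    finally show ?thesis by simp
  qed
  then show "\<exists>L. \<forall>x y. norm x \<le> R \<longrightarrow> norm y \<le> R \<longrightarrow>
      norm (inverse (g x) - inverse (g y)) \<le> L * norm (x - y)"
    by blast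
qed

text \<open>
  The mean value inequality: the continuous derivative is bounded on a ball, which is compact and convex.
\<close>
lemma lipschitz_on_balls_C1:
  fixes g :: "'a::euclidean_space \<Rightarrow> 'b::real_normed_vector" and g' :: "'a \<Rightarrow> 'a \<Rightarrow>\<^sub>L 'b"
  assumes "\<And>x. (g has_derivative blinfun_apply (g' x)) (at x)" and "continuous_on UNIV g'"
  shows "lipschitz_on_balls g"
proof (rule lipschitz_on_ballsI)
  fix R
  have "bounded (g' ` cball 0 R)"
    by (intro compact_imp_bounded compact_continuous_image continuous_on_subset[OF assms(2)]) auto
  then obtain B where "\<And>z. z \<in> g' ` cball 0 R \<Longrightarrow> norm z \<le> B"
    unfolding bounded_iff by blast
  then have B: "norm (g' x) \<le> B" if "x \<in> cball 0 R" for x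
    using that by auto
  have "norm (g x - g y) \<le> B * norm (x - y)" if "norm x \<le> R" "norm y \<le> R" for x y
  proof (rule differentiable_bound[of "cball 0 R"])
    show "(g has_derivative blinfun_apply (g' z)) (at z within cball 0 R)" for z
      using assms(1) by (rule has_derivative_at_withinI)
    show "onorm (blinfun_apply (g' z)) \<le> B" if "z \<in> cball 0 R" for z
      using B[OF that] by (simp add: norm_blinfun.rep_eq)
  qed (use that in auto)
  then show "\<exists>L. \<forall>x y. norm x \<le> R \<longrightarrow> norm y \<le> R \<longrightarrow> norm (g x - g y) \<le> L * norm (x - y)"
    by blast
qed

section \<open>The gradient of the square root of a function of class C2\<close>

lemma grad_eqI:
  assumes "GDERIV g x :> D"
  shows "grad g x = D"
  unfolding grad_def
proof (rule the_equality[where P = "\<lambda>D. GDERIV g x :> D", OF assms])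
  fix E assume "GDERIV g x :> E"
  then have "(\<lambda>h. h \<bullet> E) = (\<lambda>h. h \<bullet> D)"
    using assms unfolding gderiv_def by (rule has_derivative_unique)
  then show "E = D"
    by (metis vector_eq_ldot)
qed

text \<open>
  The gradient at \<open>x\<close> is the Riesz representative of the derivative at \<open>x\<close>. Passing to
  representatives is a contraction, by the Cauchy-Schwarz argument below, so the gradient inherits the
  Lipschitz bounds that the derivative has by the continuity of the second derivative.
\<close>
lemma C2_gradient:
  fixes f :: "'a::euclidean_space \<Rightarrow> real"
  assumes "C2 f"
  shows "\<exists>D. (\<forall>x. GDERIV f x :> D x) \<and> lipschitz_on_balls D" and "lipschitz_on_balls f"
proof -
  obtain f' :: "'a \<Rightarrow> 'a \<Rightarrow>\<^sub>L real" and f'' :: "'a \<Rightarrow> 'a \<Rightarrow>\<^sub>L 'a \<Rightarrow>\<^sub>L real"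
    where f': "\<And>x. (f has_derivative blinfun_apply (f' x)) (at x)"
      and f'': "\<And>x. (f' has_derivative blinfun_apply (f'' x)) (at x)"
      and cont: "continuous_on UNIV f''"
    using assms unfolding C2_def by blast
  define D where "D x = adjoint (blinfun_apply (f' x)) 1" for x
  have D: "h \<bullet> D x = blinfun_apply (f' x) h" for h x
    unfolding D_def by (subst adjoint_works) (auto intro: bounded_linear.linear blinfun.bounded_linear_right)
  have "lipschitz_on_balls f'"
    using f'' cont by (rule lipschitz_on_balls_C1)
  have contract: "norm (D x - D y) \<le> norm (f' x - f' y)" for x y
  proof -
    have "norm (D x - D y) * norm (D x - D y) = (D x - D y) \<bullet> (D x - D y)"
      by (simp add: dot_square_norm power2_eq_square)
    also have "\<dots> = blinfun_apply (f' x - f' y) (D x - D y)"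
      by (simp add: inner_diff_right[of "D x - D y" "D x" "D y"] D blinfun.diff_left)
    also have "\<dots> \<le> norm (f' x - f' y) * norm (D x - D y)"
      using norm_blinfun[of "f' x - f' y" "D x - D y"] by simp
    finally show ?thesis
      by (cases "norm (D x - D y) = 0") auto
  qed
  have "GDERIV f x :> D x" for x
    unfolding gderiv_def D using f' by simp
  moreover have "lipschitz_on_balls D"
    using \<open>lipschitz_on_balls f'\<close> contract unfolding lipschitz_on_balls_def lipschitz_on_def dist_norm
    by (meson order_trans)
  ultimately show "\<exists>D. (\<forall>x. GDERIV f x :> D x) \<and> lipschitz_on_balls D"
    by blast
  have "continuous_on UNIV f'"
    using f'' by (blast intro: continuous_at_imp_continuous_on has_derivative_continuous)
  with f' show "lipschitz_on_balls f"
    by (rule lipschitz_on_balls_C1)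
qed

text \<open>
  The lower bound \<open>m\<close> keeps \<open>f + c\<close> away from zero, where the square root is not differentiable.
  The chain rule gives the gradient as \<open>D x / (2 * F x)\<close>, with \<open>D\<close> the gradient of \<open>f\<close>: a product of
  functions that are Lipschitz on balls.
\<close>
lemma C2_sqrt_shift_gradient:
  fixes f :: "'a::euclidean_space \<Rightarrow> real"
  assumes "C2 f" and "0 < m" and F: "\<And>x. m \<le> sqrt_shift f c x"
  shows "GDERIV (sqrt_shift f c) x :> grad (sqrt_shift f c) x"
    and "lipschitz_on_balls (grad (sqrt_shift f c))"
    and "lipschitz_on_balls (sqrt_shift f c)"
proof -
  obtain D where D: "\<And>x. GDERIV f x :> D x" "lipschitz_on_balls D"
    using C2_gradient(1)[OF assms(1)] by blast
  have f: "lipschitz_on_balls f"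
    by (rule C2_gradient(2)[OF assms(1)])
  let ?F = "sqrt_shift f c"
  define G where "G x = (inverse (?F x) / 2) *\<^sub>R D x" for x
  have Fpos: "0 < ?F x" for x using F[of x] assms(2) by linarith
  then have pos: "0 < f x + c" for x by (simp add: sqrt_shift_def)
  have GD: "GDERIV ?F x :> G x" for x
  proof -
    have "GDERIV (\<lambda>x. f x + c) x :> D x"
      using GDERIV_add[OF D(1) GDERIV_const] by simp
    from GDERIV_DERIV_compose[OF this DERIV_real_sqrt[OF pos]]
    show ?thesis by (simp add: sqrt_shift_def[abs_def] G_def)
  qed
  then have grad: "grad ?F = G" by (intro ext grad_eqI)
  show "GDERIV ?F x :> grad ?F x" using GD grad by simp
  show Flip: "lipschitz_on_balls ?F"
  proof (rule lipschitz_on_ballsI)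
    fix R
    obtain L where L: "0 \<le> L" "\<And>x y. norm x \<le> R \<Longrightarrow> norm y \<le> R \<Longrightarrow> norm (f x - f y) \<le> L * norm (x - y)"
      by (rule lipschitz_on_ballsE[OF f, of R]) blast
    have "norm (?F x - ?F y) \<le> L / m * norm (x - y)" if "norm x \<le> R" "norm y \<le> R" for x y
    proof -
      \<comment> \<open>Differences of square roots are controlled by the conjugate, whose size is at least \<open>m\<close>.\<close>
      have "(?F x - ?F y) * (?F x + ?F y) = f x - f y"
        using pos[of x] pos[of y] by (simp add: sqrt_shift_def square_diff_square_factored[symmetric] algebra_simps)
      then have "norm (?F x - ?F y) * (?F x + ?F y) = norm (f x - f y)"
        using Fpos[of x] Fpos[of y] by (metis abs_mult abs_of_pos add_pos_pos real_norm_def)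
      then have "norm (?F x - ?F y) = norm (f x - f y) / (?F x + ?F y)"
        using Fpos[of x] Fpos[of y] by (simp add: field_simps)
      also have "\<dots> \<le> (L * norm (x - y)) / m"
        using L that assms(2) F[of x] Fpos[of y] by (intro frac_le) auto
      finally show ?thesis by simp
    qed
    then show "\<exists>L. \<forall>x y. norm x \<le> R \<longrightarrow> norm y \<le> R \<longrightarrow> norm (?F x - ?F y) \<le> L * norm (x - y)"
      by blast
  qed
  have "lipschitz_on_balls (\<lambda>x. (inverse (?F x) * (1 / 2)) *\<^sub>R D x)"
    by (intro lipschitz_on_balls_bilinear[OF bounded_bilinear_scaleR]
        lipschitz_on_balls_bilinear[OF bounded_bilinear_mult]
        lipschitz_on_balls_const lipschitz_on_balls_inverse[OF Flip assms(2) F] D(2))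
  then show "lipschitz_on_balls (grad ?F)"
    by (simp add: grad G_def[abs_def])
qed

section \<open>The system as an integral curve problem\<close>

definition momentum_field ::
  "real \<Rightarrow> ('a::euclidean_space \<Rightarrow> real) \<Rightarrow> 'a \<times> 'a \<times> real \<Rightarrow> 'a \<times> 'a \<times> real" where
  "momentum_field \<epsilon> F = (\<lambda>(\<theta>, v, r).
     ((- 2 * r) *\<^sub>R v, (1 / \<epsilon>) *\<^sub>R (- v + grad F \<theta>), - 2 * r * (norm v)\<^sup>2))"

lemma has_vector_derivative_Pair_iff:
  "((\<lambda>t. (f t, g t)) has_vector_derivative (f', g')) (at t within S) \<longleftrightarrow>
    (f has_vector_derivative f') (at t within S) \<and> (g has_vector_derivative g') (at t within S)"
  using bounded_linear.has_vector_derivative[OF bounded_linear_fst, of "\<lambda>t. (f t, g t)" "(f', g')"]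
    bounded_linear.has_vector_derivative[OF bounded_linear_snd, of "\<lambda>t. (f t, g t)" "(f', g')"]
  by (auto intro: has_vector_derivative_Pair)

lemma integral_curve_momentum_field_iff:
  "integral_curve (momentum_field \<epsilon> F) S (\<lambda>t. (\<theta> t, v t, r t)) \<longleftrightarrow> (\<forall>t\<in>S.
    (\<theta> has_vector_derivative (- 2 * r t) *\<^sub>R v t) (at t within S) \<and>
    (v has_vector_derivative (1 / \<epsilon>) *\<^sub>R (- v t + grad F (\<theta> t))) (at t within S) \<and>
    (r has_vector_derivative - 2 * r t * (norm (v t))\<^sup>2) (at t within S))"
  by (simp add: integral_curve_def momentum_field_def has_vector_derivative_Pair_iff)

lemma lipschitz_on_balls_momentum_field:
  assumes "lipschitz_on_balls (grad F)"
  shows "lipschitz_on_balls (momentum_field \<epsilon> F)"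
proof -
  have lin: "lipschitz_on_balls (fst :: 'a \<times> 'a \<times> real \<Rightarrow> _)"
    "lipschitz_on_balls (\<lambda>z :: 'a \<times> 'a \<times> real. fst (snd z))"
    "lipschitz_on_balls (\<lambda>z :: 'a \<times> 'a \<times> real. snd (snd z))"
    by (intro lipschitz_on_balls_linear bounded_linear_intros)+
  \<comment> \<open>Written with \<open>v \<bullet> v\<close> for the squared norm, the field is built from bilinear operations.\<close>
  have "lipschitz_on_balls (\<lambda>z. ((- 2 * snd (snd z)) *\<^sub>R fst (snd z),
      (1 / \<epsilon>) *\<^sub>R (- fst (snd z) + grad F (fst z)),
      - 2 * snd (snd z) * (fst (snd z) \<bullet> fst (snd z))))"
    by (intro lipschitz_on_balls_Pair lipschitz_on_balls_add lipschitz_on_balls_minus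
        lipschitz_on_balls_bilinear[OF bounded_bilinear_scaleR]
        lipschitz_on_balls_bilinear[OF bounded_bilinear_mult]
        lipschitz_on_balls_bilinear[OF bounded_bilinear_inner]
        lipschitz_on_balls_const lipschitz_on_balls_compose[OF assms] lin)
  then show ?thesis
    by (simp add: momentum_field_def case_prod_unfold dot_square_norm)
qed

lemma vector_derivative_within_Ici:
  fixes u :: "real \<Rightarrow> 'a::real_normed_vector"
  assumes "a \<le> t" "(u has_vector_derivative u') (at t within {a..})"
  shows "vector_derivative u (at t within {a..}) = u'"
proof (rule vector_derivative_within[OF _ assms(2)])
  have "t islimpt {a..t+1}" using assms(1) by (simp add: islimpt_Icc)
  then show "at t within {a..} \<noteq> bot"
    using islimpt_subset[of t "{a..t+1}" "{a..}"] by (auto simp: trivial_limit_within)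
qed

text \<open>
  Uniqueness and existence can be discussed for integral curves of a single autonomous field on the
  product space. The continuity of the derivative in the definition of a global solution is automatic,
  as the field is continuous.
\<close>
lemma global_solution_iff_integral_curve:
  assumes "\<epsilon> \<noteq> 0" and "lipschitz_on_balls (grad F)"
  shows "global_solution \<epsilon> F \<theta>\<^sub>0 v\<^sub>0 r\<^sub>0 \<theta> v r \<longleftrightarrow>
    integral_curve (momentum_field \<epsilon> F) {0..} (\<lambda>t. (\<theta> t, v t, r t)) \<and>
    \<theta> 0 = \<theta>\<^sub>0 \<and> v 0 = v\<^sub>0 \<and> r 0 = r\<^sub>0"
    (is "?L \<longleftrightarrow> ?R")
proof
  assume L: ?L
  then obtain u' where u': "\<And>t. 0 \<le> t \<Longrightarrow> ((\<lambda>t. (\<theta> t, v t, r t)) has_vector_derivative u' t) (at t within {0..})"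
    unfolding global_solution_def C1_within_def by auto
  have "(\<theta> has_vector_derivative (- 2 * r t) *\<^sub>R v t) (at t within {0..}) \<and>
    (v has_vector_derivative (1 / \<epsilon>) *\<^sub>R (- v t + grad F (\<theta> t))) (at t within {0..}) \<and>
    (r has_vector_derivative - 2 * r t * (norm (v t))\<^sup>2) (at t within {0..})" if t: "0 \<le> t" for t
  proof -
    obtain a b d where abd: "u' t = (a, b, d)" by (metis surj_pair)
    have der: "(\<theta> has_vector_derivative a) (at t within {0..})"
      "(v has_vector_derivative b) (at t within {0..})"
      "(r has_vector_derivative d) (at t within {0..})"
      using u'[OF t] by (simp_all add: abd has_vector_derivative_Pair_iff)
    have eqs: "\<epsilon> *\<^sub>R vector_derivative v (at t within {0..}) = - v t + grad F (\<theta> t)"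
        "vector_derivative r (at t within {0..}) = - 2 * r t * (norm (v t))\<^sup>2"
        "vector_derivative \<theta> (at t within {0..}) = (- 2 * r t) *\<^sub>R v t"
      using L t unfolding global_solution_def by blast+
    have "a = (- 2 * r t) *\<^sub>R v t" "d = - 2 * r t * (norm (v t))\<^sup>2" "\<epsilon> *\<^sub>R b = - v t + grad F (\<theta> t)"
      using eqs by (simp_all only: der[THEN vector_derivative_within_Ici[OF t]])
    moreover from this(3) have "b = (1 / \<epsilon>) *\<^sub>R (- v t + grad F (\<theta> t))"
      using assms(1) by (metis divide_self_if one_neq_zero scaleR_one scaleR_scaleR times_divide_eq_left mult_1)
    ultimately show ?thesis using der by simp
  qed
  then show ?R
    using L by (simp add: integral_curve_momentum_field_iff global_solution_def)
next
  assume R: ?R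
  have "continuous_on {0..} (\<lambda>t. momentum_field \<epsilon> F (\<theta> t, v t, r t))"
    by (rule continuous_on_compose2[OF lipschitz_on_balls_continuous_on
          integral_curve_continuous_on[OF R[THEN conjunct1]]])
      (auto intro: lipschitz_on_balls_momentum_field[OF assms(2)])
  then have "C1_within {0..} (\<lambda>t. (\<theta> t, v t, r t))"
    using R[THEN conjunct1] unfolding C1_within_def integral_curve_def by fast
  moreover have "\<epsilon> *\<^sub>R vector_derivative v (at t within {0..}) = - v t + grad F (\<theta> t) \<and>
        vector_derivative r (at t within {0..}) = - 2 * r t * (norm (v t))\<^sup>2 \<and>
        vector_derivative \<theta> (at t within {0..}) = (- 2 * r t) *\<^sub>R v t" if t: "0 \<le> t" for t
  proof -
    have "(\<theta> has_vector_derivative (- 2 * r t) *\<^sub>R v t) (at t within {0..})"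
      "(v has_vector_derivative (1 / \<epsilon>) *\<^sub>R (- v t + grad F (\<theta> t))) (at t within {0..})"
      "(r has_vector_derivative - 2 * r t * (norm (v t))\<^sup>2) (at t within {0..})"
      using R t by (auto simp: integral_curve_momentum_field_iff)
    from this[THEN vector_derivative_within_Ici[OF t]] show ?thesis
      using assms(1) by simp
  qed
  ultimately show ?L
    using R unfolding global_solution_def by blast
qed

section \<open>A priori estimates\<close>

text \<open>
  The integrating factor: \<open>r t\<close> times the exponential of the integral of \<open>a\<close> is constant.
\<close>
lemma linear_decay_positive:
  fixes r a :: "real \<Rightarrow> real"
  assumes "0 \<le> T" and "continuous_on {0..T} a"
    and r: "\<And>t. t \<in> {0..T} \<Longrightarrow> (r has_real_derivative - (a t * r t)) (at t within {0..T})"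
    and "0 < r 0"
  shows "0 < r T"
proof -
  define q where "q t = integral {0..t} a" for t
  have q: "(q has_real_derivative a t) (at t within {0..T})" if "t \<in> {0..T}" for t
    using integral_has_vector_derivative[OF assms(2) that]
    by (simp add: q_def[abs_def] has_real_derivative_iff_has_vector_derivative)
  have "- (r T * exp (q T)) \<le> - (r 0 * exp (q 0))"
  proof (rule nonincreasing_Icc[OF assms(1)])
    fix t assume t: "t \<in> {0..T}"
    show "((\<lambda>t. - (r t * exp (q t))) has_real_derivative 0) (at t within {0..T})"
      using r[OF t] q[OF t] by (auto intro!: derivative_eq_intros)
  qed simp
  moreover have "0 < r 0 * exp (q 0)"
    using assms(4) by simp
  ultimately have "0 < r T * exp (q T)" by linarith
  then show ?thesis by (simp add: zero_less_mult_iff)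
qed

text \<open>
  The setting of the a priori estimates, a solution on a compact time interval. The bounds on \<open>\<theta>\<close>, \<open>v\<close>
  and the energy are stated at the right end point \<open>T\<close>, as those at an earlier time follow by
  restricting the solution.
\<close>
locale momentum_curve =
  fixes F :: "'a::euclidean_space \<Rightarrow> real" and \<epsilon> T :: real
    and \<theta> v :: "real \<Rightarrow> 'a" and r :: "real \<Rightarrow> real"
  assumes GDERIV_F: "\<And>x. GDERIV F x :> grad F x"
    and eps: "0 < \<epsilon>" and T: "0 \<le> T" and r0: "0 < r 0"
    and curve: "integral_curve (momentum_field \<epsilon> F) {0..T} (\<lambda>t. (\<theta> t, v t, r t))"
begin

lemma derivatives:
  assumes "t \<in> {0..T}"
  shows "(\<theta> has_vector_derivative (- 2 * r t) *\<^sub>R v t) (at t within {0..T})"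
    and "(v has_vector_derivative (1 / \<epsilon>) *\<^sub>R (- v t + grad F (\<theta> t))) (at t within {0..T})"
    and "(r has_vector_derivative - 2 * r t * (norm (v t))\<^sup>2) (at t within {0..T})"
  using curve assms by (auto simp: integral_curve_momentum_field_iff)

lemma curve_continuous: "continuous_on {0..T} \<theta>" "continuous_on {0..T} v"
  using derivatives has_vector_derivative_continuous
  unfolding continuous_on_eq_continuous_within by blast+

lemma r_positive:
  assumes t: "t \<in> {0..T}"
  shows "0 < r t"
proof (rule linear_decay_positive[where r = r and T = t and a = "\<lambda>s. 2 * (norm (v s))\<^sup>2"])
  have sub: "{0..t} \<subseteq> {0..T}" using t by simp
  then show "continuous_on {0..t} (\<lambda>s. 2 * (norm (v s))\<^sup>2)"
    by (intro continuous_intros continuous_on_subset[OF curve_continuous(2)])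
  show "(r has_real_derivative - (2 * (norm (v s))\<^sup>2 * r s)) (at s within {0..t})" if "s \<in> {0..t}" for s
    using has_vector_derivative_within_subset[OF derivatives(3) sub, of s] that sub
    by (auto simp: has_real_derivative_iff_has_vector_derivative mult_ac)
qed (use t r0 in auto)

lemma r_le_initial: "r T \<le> r 0"
proof (rule nonincreasing_Icc[OF T])
  fix t assume t: "t \<in> {0..T}"
  show "(r has_real_derivative - 2 * r t * (norm (v t))\<^sup>2) (at t within {0..T})"
    using derivatives(3)[OF t] by (simp add: has_real_derivative_iff_has_vector_derivative)
  show "- 2 * r t * (norm (v t))\<^sup>2 \<le> 0"
    using r_positive[OF t] by simp
qed

text \<open>
  The energy is dissipated. Its derivative is
  \<open>- 2 * r * (norm v)\<^sup>2 - 2 * \<epsilon> * r * (norm v) ^ 4\<close>: the two terms with the inner product of \<open>v\<close> and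
  \<open>grad F \<theta>\<close> cancel, one coming from the motion of \<open>\<theta>\<close> and the other from that of \<open>v\<close>.
\<close>
lemma energy_le_initial:
  "F (\<theta> T) + \<epsilon> * r T * (norm (v T))\<^sup>2 \<le> F (\<theta> 0) + \<epsilon> * r 0 * (norm (v 0))\<^sup>2"
proof -
  define E where "E t = F (\<theta> t) + \<epsilon> * (r t * (v t \<bullet> v t))" for t
  have "E T \<le> E 0"
  proof (rule nonincreasing_Icc[OF T])
    fix t assume t: "t \<in> {0..T}"
    note d = derivatives[OF t, unfolded has_vector_derivative_def]
    let ?q = "v t \<bullet> v t" and ?p = "v t \<bullet> grad F (\<theta> t)"
    have F: "((\<lambda>t. F (\<theta> t)) has_real_derivative - 2 * r t * ?p) (at t within {0..T})"
      unfolding has_field_derivative_def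
      by (rule has_derivative_eq_rhs[OF has_derivative_compose[OF d(1) GDERIV_F[unfolded gderiv_def]]])
        (simp add: fun_eq_iff)
    have r: "(r has_real_derivative - 2 * r t * ?q) (at t within {0..T})"
      using derivatives(3)[OF t]
      by (simp add: has_real_derivative_iff_has_vector_derivative power2_norm_eq_inner)
    have gv: "(grad F (\<theta> t) - v t) \<bullet> v t = ?p - ?q" "v t \<bullet> (grad F (\<theta> t) - v t) = ?p - ?q"
      by (simp_all add: inner_diff_left inner_diff_right inner_commute[of "grad F (\<theta> t)" "v t"])
    have v: "((\<lambda>t. v t \<bullet> v t) has_real_derivative 2 * (1 / \<epsilon> * (?p - ?q))) (at t within {0..T})"
      unfolding has_field_derivative_def
      by (rule has_derivative_eq_rhs[OF has_derivative_inner[OF d(2) d(2)]])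
        (simp add: fun_eq_iff gv)
    have "(E has_real_derivative
        - 2 * r t * ?p + \<epsilon> * (- 2 * r t * ?q * ?q + 2 * (1 / \<epsilon> * (?p - ?q)) * r t)) (at t within {0..T})"
      unfolding E_def by (intro DERIV_add DERIV_cmult DERIV_mult F r v)
    also have "- 2 * r t * ?p + \<epsilon> * (- 2 * r t * ?q * ?q + 2 * (1 / \<epsilon> * (?p - ?q)) * r t)
        = - 2 * r t * ?q - 2 * \<epsilon> * r t * ?q\<^sup>2"
      using eps by (simp add: field_simps power2_eq_square)
    finally show "(E has_real_derivative - 2 * r t * ?q - 2 * \<epsilon> * r t * ?q\<^sup>2) (at t within {0..T})" .
    show "- 2 * r t * (v t \<bullet> v t) - 2 * \<epsilon> * r t * (v t \<bullet> v t)\<^sup>2 \<le> 0"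
    proof -
      have "0 \<le> r t * ?q" "0 \<le> \<epsilon> * r t * ?q\<^sup>2"
        using r_positive[OF t] eps by (intro mult_nonneg_nonneg; simp)+
      then show ?thesis by (simp add: mult.assoc)
    qed
  qed
  then show ?thesis by (simp add: E_def dot_square_norm mult.assoc)
qed

lemma F_le_initial_energy: "F (\<theta> T) \<le> F (\<theta> 0) + \<epsilon> * r 0 * (norm (v 0))\<^sup>2"
proof -
  have "0 \<le> \<epsilon> * r T * (norm (v T))\<^sup>2"
    using eps r_positive[of T] T by (intro mult_nonneg_nonneg) auto
  then show ?thesis using energy_le_initial by linarith
qed

text \<open>
  The velocity is an exponentially weighted average of the initial velocity and of the past gradients:
  the derivative of \<open>exp (t / \<epsilon>) *\<^sub>R v t\<close> is \<open>(exp (t / \<epsilon>) / \<epsilon>) *\<^sub>R grad F (\<theta> t)\<close>. Hence its norm cannot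
  exceed a common bound for these.
\<close>
lemma norm_v_le:
  assumes M: "\<And>s. s \<in> {0..T} \<Longrightarrow> norm (grad F (\<theta> s)) \<le> M"
  shows "norm (v T) \<le> max (norm (v 0)) M"
proof (cases "T = 0")
  case False
  with T have "0 < T" by simp
  define N where "N = max (norm (v 0)) M"
  \<comment> \<open>The derivative of \<open>N * exp (t / \<epsilon>)\<close> dominates the norm of that of \<open>exp (t / \<epsilon>) *\<^sub>R v t\<close>.\<close>
  have "norm (exp (T / \<epsilon>) *\<^sub>R v T - exp (0 / \<epsilon>) *\<^sub>R v 0)
      \<le> (\<lambda>t. N * exp (t / \<epsilon>)) T - (\<lambda>t. N * exp (t / \<epsilon>)) 0"
  proof (rule differentiable_bound_general[OF \<open>0 < T\<close>])
    show "continuous_on {0..T} (\<lambda>t. exp (t / \<epsilon>) *\<^sub>R v t)"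
      using eps by (intro continuous_intros curve_continuous) auto
    show "continuous_on {0..T} (\<lambda>t. N * exp (t / \<epsilon>))"
      using eps by (intro continuous_intros) auto
    fix t assume t: "0 < t" "t < T"
    have v: "(v has_vector_derivative (1 / \<epsilon>) *\<^sub>R (- v t + grad F (\<theta> t))) (at t)"
      using derivatives(2)[of t] t by (simp add: at_within_Icc_at)
    have e: "((\<lambda>t. exp (t / \<epsilon>)) has_real_derivative exp (t / \<epsilon>) / \<epsilon>) (at t)"
      using eps by (auto intro!: derivative_eq_intros)
    show "((\<lambda>t. exp (t / \<epsilon>) *\<^sub>R v t) has_vector_derivative (exp (t / \<epsilon>) / \<epsilon>) *\<^sub>R grad F (\<theta> t)) (at t)"
      using has_vector_derivative_scaleR[OF e v] by (simp add: algebra_simps)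
    show "((\<lambda>t. N * exp (t / \<epsilon>)) has_vector_derivative N * (exp (t / \<epsilon>) / \<epsilon>)) (at t)"
      using DERIV_cmult[OF e] by (simp add: has_real_derivative_iff_has_vector_derivative)
    show "norm ((exp (t / \<epsilon>) / \<epsilon>) *\<^sub>R grad F (\<theta> t)) \<le> N * (exp (t / \<epsilon>) / \<epsilon>)"
      using M[of t] t eps by (auto simp: N_def divide_simps max_def)
  qed
  then have "norm (exp (T / \<epsilon>) *\<^sub>R v T - v 0) \<le> N * exp (T / \<epsilon>) - N" by simp
  then have "norm (exp (T / \<epsilon>) *\<^sub>R v T) \<le> N * exp (T / \<epsilon>) - N + norm (v 0)"
    using norm_triangle_sub[of "exp (T / \<epsilon>) *\<^sub>R v T" "v 0"] by linarith
  also have "\<dots> \<le> N * exp (T / \<epsilon>)" by (simp add: N_def)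
  finally show ?thesis by (simp add: N_def)
qed simp

end

section \<open>Global solutions of the system\<close>

lemma le_max_over:
  fixes g :: "real \<Rightarrow> real"
  assumes "continuous_on {a..b} g" "s \<in> {a..b}"
  shows "g s \<le> max_over {a..b} g"
proof -
  have "\<exists>x\<in>{a..b}. \<forall>y\<in>{a..b}. g y \<le> g x"
    using assms by (intro continuous_attains_sup) auto
  then obtain x where x: "x \<in> {a..b}" "\<And>y. y \<in> {a..b} \<Longrightarrow> g y \<le> g x" by blast
  have "max_over {a..b} g = g x"
    unfolding max_over_def by (rule Greatest_equality) (use x in auto)
  with x(2) assms(2) show ?thesis by simp
qed

theorem theorem5p1:
  fixes f :: "real ^ 'n \<Rightarrow> real" and c \<epsilon> r\<^sub>0 :: real and \<theta>\<^sub>0 v\<^sub>0 :: "real ^ 'n"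
  assumes "C2 f"
    and "filterlim f at_top at_infinity"
    and "bdd_below (range f)"
    and "\<And>x. sqrt_shift f c x \<ge> sqrt (min_value f + c)"
    and "sqrt (min_value f + c) > 0"
    and "\<epsilon> > 0" and "r\<^sub>0 > 0"
  shows "\<exists>\<theta> v r. global_solution \<epsilon> (sqrt_shift f c) \<theta>\<^sub>0 v\<^sub>0 r\<^sub>0 \<theta> v r \<and>
    (\<forall>\<theta>' v' r'. global_solution \<epsilon> (sqrt_shift f c) \<theta>\<^sub>0 v\<^sub>0 r\<^sub>0 \<theta>' v' r' \<longrightarrow>
       (\<forall>t\<ge>0. \<theta>' t = \<theta> t \<and> v' t = v t \<and> r' t = r t)) \<and>
    (\<forall>t>0.
       \<theta> t \<in> {x. sqrt_shift f c x \<le> sqrt_shift f c \<theta>\<^sub>0 + \<epsilon> * r\<^sub>0 * (norm v\<^sub>0)\<^sup>2} \<and>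
       norm (v t) \<le> max (norm (v 0))
         (max_over {0..t} (\<lambda>s. norm (grad (sqrt_shift f c) (\<theta> s)))) \<and>
       0 < r t \<and> r t \<le> r\<^sub>0)"
proof -
  let ?F = "sqrt_shift f c"
  let ?X = "momentum_field \<epsilon> ?F"
  note F = C2_sqrt_shift_gradient[OF assms(1,5,4)]
  have lip: "lipschitz_on_balls ?X"
    by (rule lipschitz_on_balls_momentum_field[OF F(2)])
  note sol = global_solution_iff_integral_curve[OF less_imp_neq[OF \<open>\<epsilon> > 0\<close>, symmetric] F(2)]

  \<comment> \<open>Coercivity bounds the sublevel set of the initial energy, and the gradient is bounded there.\<close>
  define E where "E = ?F \<theta>\<^sub>0 + \<epsilon> * r\<^sub>0 * (norm v\<^sub>0)\<^sup>2"
  have "eventually (\<lambda>x. E\<^sup>2 - c < f x) at_infinity"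
    using assms(2) by (simp add: filterlim_at_top_dense)
  then obtain b where b: "\<And>x. b \<le> norm x \<Longrightarrow> E\<^sup>2 - c < f x"
    by (auto simp: eventually_at_infinity)
  have sublevel: "norm x \<le> b" if "?F x \<le> E" for x
  proof (rule ccontr)
    assume "\<not> norm x \<le> b"
    then have "E\<^sup>2 < f x + c" using b[of x] by simp
    then have "E < ?F x" unfolding sqrt_shift_def by (rule real_less_rsqrt)
    with that show False by simp
  qed
  obtain M where M: "0 \<le> M" "\<And>x. norm x \<le> b \<Longrightarrow> norm (grad ?F x) \<le> M"
    by (rule lipschitz_on_balls_bounded[OF F(2), of b]) blast

  \<comment> \<open>The estimates for solutions on compact intervals give a bound that does not depend on the interval.\<close>
  obtain z where z0: "z 0 = (\<theta>\<^sub>0, v\<^sub>0, r\<^sub>0)" and z: "integral_curve ?X {0..} z"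
  proof (rule global_integral_curve_a_priori_bound[OF lip, of "(\<theta>\<^sub>0, v\<^sub>0, r\<^sub>0)"])
    fix T :: real and x :: "real \<Rightarrow> (real ^ 'n) \<times> (real ^ 'n) \<times> real"
    assume T: "0 \<le> T" and x: "integral_curve ?X {0..T} x" and x0: "x 0 = (\<theta>\<^sub>0, v\<^sub>0, r\<^sub>0)"
    define \<theta> v r where "\<theta> t = fst (x t)" and "v t = fst (snd (x t))" and "r t = snd (snd (x t))" for t
    have init: "\<theta> 0 = \<theta>\<^sub>0" "v 0 = v\<^sub>0" "r 0 = r\<^sub>0" by (simp_all add: \<theta>_def v_def r_def x0)
    have curve: "integral_curve ?X {0..t} (\<lambda>t. (\<theta> t, v t, r t))" if "t \<in> {0..T}" for t
      using integral_curve_subset[OF x, of "{0..t}"] that by (simp add: \<theta>_def v_def r_def)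
    have curve_loc: "momentum_curve ?F \<epsilon> t \<theta> v r" if "t \<in> {0..T}" for t
      using that assms(6,7) F(1) curve by unfold_locales (auto simp: init)
    have \<theta>: "norm (\<theta> t) \<le> b" if "t \<in> {0..T}" for t
      using momentum_curve.F_le_initial_energy[OF curve_loc[OF that]]
      by (intro sublevel) (simp add: init E_def)
    interpret momentum_curve ?F \<epsilon> T \<theta> v r
      by (rule curve_loc) (use T in simp)
    have "norm (v T) \<le> max (norm v\<^sub>0) M"
      using norm_v_le[of M] M \<theta> by (simp add: init)
    moreover have "\<bar>r T\<bar> \<le> r\<^sub>0"
      using r_positive[of T] r_le_initial T by (simp add: init)
    moreover have "norm (x T) \<le> norm (\<theta> T) + (norm (v T) + norm (r T))"
      using norm_Pair_le[of "\<theta> T" "(v T, r T)"] norm_Pair_le[of "v T" "r T"]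
      by (simp add: \<theta>_def v_def r_def)
    ultimately show "norm (x T) \<le> b + (max (norm v\<^sub>0) M + r\<^sub>0)"
      using \<theta>[of T] T by simp
  qed
  define \<theta> v r where "\<theta> t = fst (z t)" and "v t = fst (snd (z t))" and "r t = snd (snd (z t))" for t
  have init: "\<theta> 0 = \<theta>\<^sub>0" "v 0 = v\<^sub>0" "r 0 = r\<^sub>0" by (simp_all add: \<theta>_def v_def r_def z0)
  have curve: "integral_curve ?X {0..} (\<lambda>t. (\<theta> t, v t, r t))"
    using z by (simp add: \<theta>_def v_def r_def)
  show ?thesis
  proof (intro exI conjI)
    show "global_solution \<epsilon> ?F \<theta>\<^sub>0 v\<^sub>0 r\<^sub>0 \<theta> v r"
      unfolding sol using curve init by blast
    show "\<forall>\<theta>' v' r'. global_solution \<epsilon> ?F \<theta>\<^sub>0 v\<^sub>0 r\<^sub>0 \<theta>' v' r' \<longrightarrow>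
       (\<forall>t\<ge>0. \<theta>' t = \<theta> t \<and> v' t = v t \<and> r' t = r t)"
    proof (intro allI impI)
      fix \<theta>' v' r' and t :: real
      assume "global_solution \<epsilon> ?F \<theta>\<^sub>0 v\<^sub>0 r\<^sub>0 \<theta>' v' r'" and t: "0 \<le> t"
      then have s: "integral_curve ?X {0..} (\<lambda>t. (\<theta>' t, v' t, r' t))" "\<theta>' 0 = \<theta>\<^sub>0" "v' 0 = v\<^sub>0" "r' 0 = r\<^sub>0"
        unfolding sol by blast+
      have "(\<theta>' t, v' t, r' t) = (\<theta> t, v t, r t)"
        by (rule integral_curve_unique[OF lip t integral_curve_subset[OF s(1)] integral_curve_subset[OF curve]])
          (auto simp: s init)
      then show "\<theta>' t = \<theta> t \<and> v' t = v t \<and> r' t = r t" by simp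
    qed
    show "\<forall>t>0. \<theta> t \<in> {x. ?F x \<le> ?F \<theta>\<^sub>0 + \<epsilon> * r\<^sub>0 * (norm v\<^sub>0)\<^sup>2} \<and>
       norm (v t) \<le> max (norm (v 0)) (max_over {0..t} (\<lambda>s. norm (grad ?F (\<theta> s)))) \<and>
       0 < r t \<and> r t \<le> r\<^sub>0"
    proof (intro allI impI)
      fix t :: real assume "0 < t"
      then have t: "0 \<le> t" by simp
      interpret momentum_curve ?F \<epsilon> t \<theta> v r
        using t assms(6,7) F(1) integral_curve_subset[OF curve, of "{0..t}"]
        by unfold_locales (auto simp: init)
      have "continuous_on {0..t} (\<lambda>s. norm (grad ?F (\<theta> s)))"
        by (intro continuous_on_norm continuous_on_compose2[OF lipschitz_on_balls_continuous_on[OF F(2)]]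
            curve_continuous(1)) auto
      from norm_v_le[OF le_max_over[OF this]] show "\<theta> t \<in> {x. ?F x \<le> ?F \<theta>\<^sub>0 + \<epsilon> * r\<^sub>0 * (norm v\<^sub>0)\<^sup>2} \<and>
         norm (v t) \<le> max (norm (v 0)) (max_over {0..t} (\<lambda>s. norm (grad ?F (\<theta> s)))) \<and>
         0 < r t \<and> r t \<le> r\<^sub>0"
        using F_le_initial_energy r_positive[of t] r_le_initial t
        by (simp add: init)
    qed
  qed
qed

end
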